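(* Let $R$ be a prime ring with left Krull dimension less than or equal to $1$, and let $M$ be a faithful $*$-prime left $R$-module. Then $\mathrm{End}_R(M)$ is a prime ring.
   Context: Rings are associative and unital. Homomorphisms of left modules are written on the right of their arguments. For submodules $N,L$ of $M$ put $N*L = N\,\mathrm{Hom}_R(M,L)=\sum\{(N)f \mid f\in \mathrm{Hom}_R(M,L)\}$. $M$ is called $*$-prime if $N*L\neq 0$ for all non-zero submodules $N,L$ of $M$. Following the paper's description, a ring $R$ has left Krull dimension $0$ if it is left artinian, and left Krull dimension (at most) $1$ if every proper cyclic left $R$-module, i.e. every $R/I$ with $I$ a non-zero left ideal of $R$, is artinian. *)

theory Defs
  imports "HOL-Algebra.Module" "HOL-Algebra.Ideal_Product" "HOL-Algebra.Generated_Groups"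
begin

section \<open>Prime rings\<close>

locale prime_ring = ring R for R (structure) +
  assumes one_neq_zero: "\<one> \<noteq> \<zero>"
    and prime: "\<lbrakk>ideal I R; ideal J R; ideal_prod R I J = {\<zero>}\<rbrakk> \<Longrightarrow> I = {\<zero>} \<or> J = {\<zero>}"


section \<open>Left modules over arbitrary rings\<close>

text \<open>The library locale \<^locale>\<open>module\<close> demands a commutative base ring. The axioms
  below are the same, over a \<^locale>\<open>ring\<close>. The library's \<^locale>\<open>submodule\<close> does not
  depend on commutativity and is used unchanged.\<close>

locale left_module = R?: ring R + M?: abelian_group M
  for R :: "('a, 'c) ring_scheme" (structure) and M :: "('a, 'b, 'd) module_scheme" (structure) +
  assumes smult_closed [simp, intro]:
      "\<lbrakk>a \<in> carrier R; x \<in> carrier M\<rbrakk> \<Longrightarrow> a \<odot>\<^bsub>M\<^esub> x \<in> carrier M"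
    and smult_l_distr:
      "\<lbrakk>a \<in> carrier R; b \<in> carrier R; x \<in> carrier M\<rbrakk> \<Longrightarrow>
        (a \<oplus> b) \<odot>\<^bsub>M\<^esub> x = a \<odot>\<^bsub>M\<^esub> x \<oplus>\<^bsub>M\<^esub> b \<odot>\<^bsub>M\<^esub> x"
    and smult_r_distr:
      "\<lbrakk>a \<in> carrier R; x \<in> carrier M; y \<in> carrier M\<rbrakk> \<Longrightarrow>
        a \<odot>\<^bsub>M\<^esub> (x \<oplus>\<^bsub>M\<^esub> y) = a \<odot>\<^bsub>M\<^esub> x \<oplus>\<^bsub>M\<^esub> a \<odot>\<^bsub>M\<^esub> y"
    and smult_assoc1:
      "\<lbrakk>a \<in> carrier R; b \<in> carrier R; x \<in> carrier M\<rbrakk> \<Longrightarrow>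
        (a \<otimes> b) \<odot>\<^bsub>M\<^esub> x = a \<odot>\<^bsub>M\<^esub> (b \<odot>\<^bsub>M\<^esub> x)"
    and smult_one [simp]:
      "x \<in> carrier M \<Longrightarrow> \<one> \<odot>\<^bsub>M\<^esub> x = x"

definition faithful_module :: "('a, 'c) ring_scheme \<Rightarrow> ('a, 'b, 'd) module_scheme \<Rightarrow> bool" where
  "faithful_module R M \<longleftrightarrow>
     (\<forall>r\<in>carrier R. (\<forall>x\<in>carrier M. r \<odot>\<^bsub>M\<^esub> x = \<zero>\<^bsub>M\<^esub>) \<longrightarrow> r = \<zero>\<^bsub>R\<^esub>)"

definition artinian_module :: "('a, 'c) ring_scheme \<Rightarrow> ('a, 'b, 'd) module_scheme \<Rightarrow> bool" where
  "artinian_module R M \<longleftrightarrow>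
     (\<forall>N :: nat \<Rightarrow> 'b set. (\<forall>i. submodule (N i) R M) \<and> (\<forall>i. N (Suc i) \<subseteq> N i)
        \<longrightarrow> (\<exists>n. \<forall>i\<ge>n. N i = N n))"

text \<open>The multiplication and unit fields of a module record carry no meaning for a module.\<close>

definition quotient_module ::
    "('a, 'c) ring_scheme \<Rightarrow> ('a, 'b, 'd) module_scheme \<Rightarrow> 'b set \<Rightarrow> ('a, 'b set) module" where
  "quotient_module R M N =
     \<lparr>carrier = a_rcosets\<^bsub>M\<^esub> N, mult = undefined, one = undefined,
      zero = N, add = set_add M, smult = (\<lambda>r C. \<Union>x\<in>C. N +>\<^bsub>M\<^esub> (r \<odot>\<^bsub>M\<^esub> x))\<rparr>"

definition regular_module :: "('a, 'c) ring_scheme \<Rightarrow> ('a, 'a) module" where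
  "regular_module R =
     \<lparr>carrier = carrier R, mult = mult R, one = one R, zero = zero R, add = add R,
      smult = mult R\<rparr>"

abbreviation left_ideal :: "'a set \<Rightarrow> ('a, 'c) ring_scheme \<Rightarrow> bool" where
  "left_ideal I R \<equiv> submodule I R (regular_module R)"

text \<open>This includes left Krull dimension 0: if \<open>R\<close> is left artinian, so is each \<open>R/I\<close>.\<close>

definition left_krull_dim_le_1 :: "('a, 'c) ring_scheme \<Rightarrow> bool" where
  "left_krull_dim_le_1 R \<longleftrightarrow>
     (\<forall>I. left_ideal I R \<and> I \<noteq> {\<zero>\<^bsub>R\<^esub>}
        \<longrightarrow> artinian_module R (quotient_module R (regular_module R) I))"


section \<open>Homomorphisms and the endomorphism ring\<close>

text \<open>Homomorphisms are extensional functions, so that equality of homomorphisms is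
  equality on the carrier.\<close>

definition left_module_hom ::
    "('a, 'c) ring_scheme \<Rightarrow> ('a, 'b, 'd) module_scheme \<Rightarrow> ('a, 'e, 'f) module_scheme \<Rightarrow> ('b \<Rightarrow> 'e) set" where
  "left_module_hom R M N =
     {f \<in> carrier M \<rightarrow>\<^sub>E carrier N.
        (\<forall>x\<in>carrier M. \<forall>y\<in>carrier M. f (x \<oplus>\<^bsub>M\<^esub> y) = f x \<oplus>\<^bsub>N\<^esub> f y) \<and>
        (\<forall>r\<in>carrier R. \<forall>x\<in>carrier M. f (r \<odot>\<^bsub>M\<^esub> x) = r \<odot>\<^bsub>N\<^esub> f x)}"

text \<open>Homomorphisms of left modules act on the right of their arguments, so the product of
  \<open>f\<close> and \<open>g\<close> applies \<open>f\<close> first.\<close>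

definition End_ring :: "('a, 'c) ring_scheme \<Rightarrow> ('a, 'b, 'd) module_scheme \<Rightarrow> ('b \<Rightarrow> 'b) ring" where
  "End_ring R M =
     \<lparr>carrier = left_module_hom R M M,
      mult = (\<lambda>f g. compose (carrier M) g f),
      one = (\<lambda>x\<in>carrier M. x),
      zero = (\<lambda>x\<in>carrier M. \<zero>\<^bsub>M\<^esub>),
      add = (\<lambda>f g. \<lambda>x\<in>carrier M. f x \<oplus>\<^bsub>M\<^esub> g x)\<rparr>"


section \<open>The star product and star-prime modules\<close>

text \<open>The sum of the submodules \<open>(N)f\<close> is the additive subgroup generated by their union.\<close>

definition star_prod ::
    "('a, 'c) ring_scheme \<Rightarrow> ('a, 'b, 'd) module_scheme \<Rightarrow> 'b set \<Rightarrow> 'b set \<Rightarrow> 'b set" where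
  "star_prod R M N L =
     generate (add_monoid M) (\<Union>f\<in>left_module_hom R M (M\<lparr>carrier := L\<rparr>). f ` N)"

definition star_prime :: "('a, 'c) ring_scheme \<Rightarrow> ('a, 'b, 'd) module_scheme \<Rightarrow> bool" where
  "star_prime R M \<longleftrightarrow>
     (\<forall>N L. submodule N R M \<and> submodule L R M \<and> N \<noteq> {\<zero>\<^bsub>M\<^esub>} \<and> L \<noteq> {\<zero>\<^bsub>M\<^esub>}
        \<longrightarrow> star_prod R M N L \<noteq> {\<zero>\<^bsub>M\<^esub>})"

end

(* Star-primeness says that M is cogenerated by each of its non-zero submodules.
   It suffices to find, for y and g non-zero, an endomorphism p with g(p(y)) non-zero.

   If some x in M has zero annihilator, a homomorphism h : M -> Rx with h(y) = rx, r non-zero,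
   can be followed by x |-> w for every w in M.  If none of these works, then r kills g(M),
   which cogenerates M, so r kills M, against faithfulness.

   Otherwise every cyclic submodule of M is artinian.  Take S simple in Ry and C minimal
   among the submodules of a cyclic one on which g does not vanish.  Since S cogenerates M,
   minimality forces C to be isomorphic to S, and p is the composite M -> S -> C of a
   homomorphism not killing y with this isomorphism. *)

theory Submission
  imports Defs
begin

section \<open>Left modules\<close>

context left_module
begin

lemma smult_r_null [simp]:
  assumes "a \<in> carrier R"
  shows "a \<odot>\<^bsub>M\<^esub> \<zero>\<^bsub>M\<^esub> = \<zero>\<^bsub>M\<^esub>"
proof -
  have "a \<odot>\<^bsub>M\<^esub> \<zero>\<^bsub>M\<^esub> \<oplus>\<^bsub>M\<^esub> a \<odot>\<^bsub>M\<^esub> \<zero>\<^bsub>M\<^esub> = a \<odot>\<^bsub>M\<^esub> \<zero>\<^bsub>M\<^esub>"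
    using assms smult_r_distr[of a "\<zero>\<^bsub>M\<^esub>" "\<zero>\<^bsub>M\<^esub>"] by simp
  then show ?thesis
    using assms M.add.r_cancel_one' smult_closed[OF assms M.zero_closed] by metis
qed

lemma smult_l_null [simp]:
  assumes "x \<in> carrier M"
  shows "\<zero> \<odot>\<^bsub>M\<^esub> x = \<zero>\<^bsub>M\<^esub>"
proof -
  have "\<zero> \<odot>\<^bsub>M\<^esub> x \<oplus>\<^bsub>M\<^esub> \<zero> \<odot>\<^bsub>M\<^esub> x = \<zero> \<odot>\<^bsub>M\<^esub> x"
    using assms smult_l_distr[of "\<zero>" "\<zero>" x] by simp
  then show ?thesis
    using assms M.add.r_cancel_one' smult_closed[OF R.zero_closed assms] by metis
qed

lemma smult_l_minus:
  assumes "a \<in> carrier R" "x \<in> carrier M"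
  shows "(\<ominus> a) \<odot>\<^bsub>M\<^esub> x = \<ominus>\<^bsub>M\<^esub> (a \<odot>\<^bsub>M\<^esub> x)"
proof (rule M.minus_equality[symmetric])
  show "(\<ominus> a) \<odot>\<^bsub>M\<^esub> x \<oplus>\<^bsub>M\<^esub> a \<odot>\<^bsub>M\<^esub> x = \<zero>\<^bsub>M\<^esub>"
    using assms smult_l_distr[of "\<ominus> a" a x] by (simp add: R.l_neg)
qed (use assms in auto)

lemma smult_minus_one:
  assumes "x \<in> carrier M"
  shows "(\<ominus> \<one>) \<odot>\<^bsub>M\<^esub> x = \<ominus>\<^bsub>M\<^esub> x"
  using assms smult_l_minus[of \<one> x] by simp

text \<open>Negation is the scalar \<open>\<ominus> \<one>\<close>, so closure under scalars already
  supplies the inverses that \<open>subgroup\<close> demands.\<close>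

lemma left_submoduleI:
  assumes "H \<subseteq> carrier M" "\<zero>\<^bsub>M\<^esub> \<in> H"
    and "\<And>x y. x \<in> H \<Longrightarrow> y \<in> H \<Longrightarrow> x \<oplus>\<^bsub>M\<^esub> y \<in> H"
    and s: "\<And>a x. a \<in> carrier R \<Longrightarrow> x \<in> H \<Longrightarrow> a \<odot>\<^bsub>M\<^esub> x \<in> H"
  shows "submodule H R M"
proof -
  have "\<ominus>\<^bsub>M\<^esub> x \<in> H" if "x \<in> H" for x
    using s[of "\<ominus> \<one>" x] smult_minus_one[of x] that assms(1) by auto
  then show ?thesis
    using assms by (intro submodule.intro subgroup.intro) (auto simp: submodule_axioms_def a_inv_def)
qed

lemma left_submoduleD:
  assumes "submodule H R M"
  shows "H \<subseteq> carrier M" "\<zero>\<^bsub>M\<^esub> \<in> H"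
    and "\<And>x y. x \<in> H \<Longrightarrow> y \<in> H \<Longrightarrow> x \<oplus>\<^bsub>M\<^esub> y \<in> H"
    and "\<And>a x. a \<in> carrier R \<Longrightarrow> x \<in> H \<Longrightarrow> a \<odot>\<^bsub>M\<^esub> x \<in> H"
    and "\<And>x. x \<in> H \<Longrightarrow> \<ominus>\<^bsub>M\<^esub> x \<in> H"
    and "\<And>x y. x \<in> H \<Longrightarrow> y \<in> H \<Longrightarrow> x \<ominus>\<^bsub>M\<^esub> y \<in> H"
  using submodule.axioms(1)[OF assms, THEN subgroup.subset]
    submodule.axioms(1)[OF assms, THEN subgroup.one_closed]
    submodule.axioms(1)[OF assms, THEN subgroup.m_closed]
    submodule.axioms(1)[OF assms, THEN subgroup.m_inv_closed]
    submodule.smult_closed[OF assms]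
  by (auto simp: a_inv_def a_minus_def)

section \<open>Cyclic submodules\<close>

definition cyclic_submodule :: "'b \<Rightarrow> 'b set" where
  "cyclic_submodule x = (\<lambda>r. r \<odot>\<^bsub>M\<^esub> x) ` carrier R"

lemma generator_in_cyclic_submodule: "x \<in> carrier M \<Longrightarrow> x \<in> cyclic_submodule x"
  unfolding cyclic_submodule_def by (rule image_eqI[of _ _ \<one>]) auto

lemma submodule_cyclic_submodule:
  assumes "x \<in> carrier M"
  shows "submodule (cyclic_submodule x) R M"
proof (rule left_submoduleI)
  show "\<zero>\<^bsub>M\<^esub> \<in> cyclic_submodule x"
    unfolding cyclic_submodule_def using assms by (intro image_eqI[of _ _ \<zero>]) auto
next
  fix u v assume "u \<in> cyclic_submodule x" "v \<in> cyclic_submodule x"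
  then obtain a b where "a \<in> carrier R" "b \<in> carrier R" "u = a \<odot>\<^bsub>M\<^esub> x" "v = b \<odot>\<^bsub>M\<^esub> x"
    unfolding cyclic_submodule_def by auto
  then show "u \<oplus>\<^bsub>M\<^esub> v \<in> cyclic_submodule x"
    unfolding cyclic_submodule_def using assms smult_l_distr
    by (intro image_eqI[of _ _ "a \<oplus> b"]) auto
next
  fix r u assume "r \<in> carrier R" "u \<in> cyclic_submodule x"
  moreover then obtain a where "a \<in> carrier R" "u = a \<odot>\<^bsub>M\<^esub> x"
    unfolding cyclic_submodule_def by auto
  ultimately show "r \<odot>\<^bsub>M\<^esub> u \<in> cyclic_submodule x"
    unfolding cyclic_submodule_def using assms smult_assoc1
    by (intro image_eqI[of _ _ "r \<otimes> a"]) auto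
qed (use assms in \<open>auto simp: cyclic_submodule_def\<close>)


section \<open>Endomorphisms\<close>

abbreviation End :: "('b \<Rightarrow> 'b) set" where
  "End \<equiv> left_module_hom R M M"

lemma End_memI:
  assumes "\<And>x. x \<in> carrier M \<Longrightarrow> f x \<in> carrier M"
    and "\<And>x y. x \<in> carrier M \<Longrightarrow> y \<in> carrier M \<Longrightarrow> f (x \<oplus>\<^bsub>M\<^esub> y) = f x \<oplus>\<^bsub>M\<^esub> f y"
    and "\<And>r x. r \<in> carrier R \<Longrightarrow> x \<in> carrier M \<Longrightarrow> f (r \<odot>\<^bsub>M\<^esub> x) = r \<odot>\<^bsub>M\<^esub> f x"
  shows "restrict f (carrier M) \<in> End"
  using assms unfolding left_module_hom_def by auto

lemma End_closed [simp]: "f \<in> End \<Longrightarrow> x \<in> carrier M \<Longrightarrow> f x \<in> carrier M"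
  unfolding left_module_hom_def by auto

lemma End_add: "f \<in> End \<Longrightarrow> x \<in> carrier M \<Longrightarrow> y \<in> carrier M \<Longrightarrow> f (x \<oplus>\<^bsub>M\<^esub> y) = f x \<oplus>\<^bsub>M\<^esub> f y"
  unfolding left_module_hom_def by auto

lemma End_smult: "f \<in> End \<Longrightarrow> r \<in> carrier R \<Longrightarrow> x \<in> carrier M \<Longrightarrow> f (r \<odot>\<^bsub>M\<^esub> x) = r \<odot>\<^bsub>M\<^esub> f x"
  unfolding left_module_hom_def by auto

lemma End_extensional: "f \<in> End \<Longrightarrow> f \<in> extensional (carrier M)"
  unfolding left_module_hom_def by (auto simp: PiE_def)

lemma End_zero: "f \<in> End \<Longrightarrow> f \<zero>\<^bsub>M\<^esub> = \<zero>\<^bsub>M\<^esub>"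
  using End_smult[of f \<zero> "\<zero>\<^bsub>M\<^esub>"] by simp

lemma End_minus:
  assumes "f \<in> End" "x \<in> carrier M" "y \<in> carrier M"
  shows "f (x \<ominus>\<^bsub>M\<^esub> y) = f x \<ominus>\<^bsub>M\<^esub> f y"
proof -
  have "f (\<ominus>\<^bsub>M\<^esub> y) = \<ominus>\<^bsub>M\<^esub> (f y)"
    using assms End_smult[of f "\<ominus> \<one>" y] smult_minus_one by simp
  then show ?thesis using assms by (simp add: a_minus_def End_add)
qed

lemma End_eqI:
  assumes "f \<in> End" "g \<in> End" "\<And>x. x \<in> carrier M \<Longrightarrow> f x = g x"
  shows "f = g"
  using assms End_extensional extensionalityI by blast

lemma End_compose: "f \<in> End \<Longrightarrow> g \<in> End \<Longrightarrow> compose (carrier M) g f \<in> End"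
  unfolding compose_def by (rule End_memI) (auto simp: End_add End_smult)

section \<open>Images and kernels of endomorphisms\<close>

lemma submodule_End_image:
  assumes "f \<in> End" "submodule N R M"
  shows "submodule (f ` N) R M"
proof (rule left_submoduleI)
  note N = left_submoduleD[OF assms(2)]
  show "f ` N \<subseteq> carrier M" using N(1) assms(1) by auto
  show "\<zero>\<^bsub>M\<^esub> \<in> f ` N" using N(2) End_zero[OF assms(1)] by force
  fix u assume "u \<in> f ` N"
  then obtain x where x: "x \<in> N" "u = f x" by auto
  show "r \<odot>\<^bsub>M\<^esub> u \<in> f ` N" if "r \<in> carrier R" for r
    using that x N(1,4) End_smult[OF assms(1), of r x] by (intro image_eqI[of _ _ "r \<odot>\<^bsub>M\<^esub> x"]) auto
  fix v assume "v \<in> f ` N"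
  then obtain y where y: "y \<in> N" "v = f y" by auto
  moreover have "x \<in> carrier M" "y \<in> carrier M" using x(1) y(1) N(1) by auto
  ultimately show "u \<oplus>\<^bsub>M\<^esub> v \<in> f ` N"
    using x N(3) End_add[OF assms(1), of x y] by (intro image_eqI[of _ _ "x \<oplus>\<^bsub>M\<^esub> y"]) auto
qed

lemma submodule_inter_kernel:
  assumes "f \<in> End" "submodule N R M"
  shows "submodule {x \<in> N. f x = \<zero>\<^bsub>M\<^esub>} R M"
  using left_submoduleD[OF assms(2)] assms(1)
  by (intro left_submoduleI) (auto simp: End_zero End_add End_smult subset_iff)

section \<open>The endomorphism ring and a criterion for its primeness\<close>

lemma ring_End_ring: "ring (End_ring R M)"
proof (rule ringI)
  have add: "(\<lambda>x\<in>carrier M. f x \<oplus>\<^bsub>M\<^esub> g x) \<in> End" if "f \<in> End" "g \<in> End" for f g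
    using that by (intro End_memI) (auto simp: End_add End_smult smult_r_distr M.a_ac)
  have zero: "(\<lambda>x\<in>carrier M. \<zero>\<^bsub>M\<^esub>) \<in> End"
    by (intro End_memI) auto
  \<comment> \<open>The negative of \<open>f\<close> is written as \<open>f\<close> followed by the
    scalar -1. This is linear because -1 commutes with every scalar.\<close>
  have neg: "(\<lambda>x\<in>carrier M. (\<ominus> \<one>) \<odot>\<^bsub>M\<^esub> f x) \<in> End" if "f \<in> End" for f
    using that smult_assoc1[symmetric]
    by (intro End_memI) (auto simp: End_add End_smult smult_r_distr R.l_minus R.r_minus)
  have one: "(\<lambda>x\<in>carrier M. x) \<in> End"
    by (intro End_memI) auto
  show "abelian_group (End_ring R M)"
  proof (rule abelian_groupI)
    fix f assume "f \<in> carrier (End_ring R M)"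
    then have f: "f \<in> End" by (simp add: End_ring_def)
    have "(\<lambda>x\<in>carrier M. (\<lambda>x\<in>carrier M. (\<ominus> \<one>) \<odot>\<^bsub>M\<^esub> f x) x \<oplus>\<^bsub>M\<^esub> f x) = (\<lambda>x\<in>carrier M. \<zero>\<^bsub>M\<^esub>)"
      using f by (intro End_eqI add neg zero) (auto simp: smult_minus_one M.l_neg)
    then show "\<exists>g\<in>carrier (End_ring R M). g \<oplus>\<^bsub>End_ring R M\<^esub> f = \<zero>\<^bsub>End_ring R M\<^esub>"
      using neg[OF f] by (auto simp: End_ring_def intro!: bexI[of _ "\<lambda>x\<in>carrier M. (\<ominus> \<one>) \<odot>\<^bsub>M\<^esub> f x"])
  next
    fix f assume "f \<in> carrier (End_ring R M)"
    then have f: "f \<in> End" by (simp add: End_ring_def)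
    show "\<zero>\<^bsub>End_ring R M\<^esub> \<oplus>\<^bsub>End_ring R M\<^esub> f = f"
      using End_eqI[OF add[OF zero f] f] f by (simp add: End_ring_def)
  qed (auto simp: End_ring_def add zero M.a_ac intro!: restrict_ext)
  show "Group.monoid (End_ring R M)"
  proof (rule monoidI)
    fix f g h
    assume "f \<in> carrier (End_ring R M)" "g \<in> carrier (End_ring R M)" "h \<in> carrier (End_ring R M)"
    then show "f \<otimes>\<^bsub>End_ring R M\<^esub> g \<otimes>\<^bsub>End_ring R M\<^esub> h = f \<otimes>\<^bsub>End_ring R M\<^esub> (g \<otimes>\<^bsub>End_ring R M\<^esub> h)"
      by (auto simp: End_ring_def compose_def intro!: restrict_ext)
  next
    fix f assume "f \<in> carrier (End_ring R M)"
    then have f: "f \<in> End" by (simp add: End_ring_def)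
    show "\<one>\<^bsub>End_ring R M\<^esub> \<otimes>\<^bsub>End_ring R M\<^esub> f = f" "f \<otimes>\<^bsub>End_ring R M\<^esub> \<one>\<^bsub>End_ring R M\<^esub> = f"
      using End_eqI[OF End_compose[OF one f] f] End_eqI[OF End_compose[OF f one] f] f
      by (simp_all add: End_ring_def compose_def)
  qed (auto simp: End_ring_def End_compose one)
qed (auto simp: End_ring_def compose_def End_add intro!: restrict_ext)

text \<open>For non-zero \<open>f\<close> in one ideal and non-zero \<open>g\<close> in the other,
  the hypothesis yields \<open>p\<close> such that the product of \<open>f\<close>, \<open>p\<close>
  and \<open>g\<close> is non-zero, and this product lies in the product of the ideals.\<close>

lemma prime_ring_End_ringI:
  assumes nontrivial: "carrier M \<noteq> {\<zero>\<^bsub>M\<^esub>}"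
    and *: "\<And>y z g. y \<in> carrier M \<Longrightarrow> y \<noteq> \<zero>\<^bsub>M\<^esub> \<Longrightarrow> z \<in> carrier M \<Longrightarrow> g \<in> End \<Longrightarrow> g z \<noteq> \<zero>\<^bsub>M\<^esub> \<Longrightarrow>
        \<exists>p\<in>End. g (p y) \<noteq> \<zero>\<^bsub>M\<^esub>"
  shows "prime_ring (End_ring R M)"
proof -
  interpret E: ring "End_ring R M" by (rule ring_End_ring)
  \<comment> \<open>Endomorphisms are extensional, so one that vanishes on the carrier is the zero
    of the ring.\<close>
  have nonzero: "\<exists>x\<in>carrier M. f x \<noteq> \<zero>\<^bsub>M\<^esub>" if "f \<in> End" "f \<noteq> \<zero>\<^bsub>End_ring R M\<^esub>" for f
  proof (rule ccontr)
    assume "\<not> ?thesis"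
    then have "f = \<zero>\<^bsub>End_ring R M\<^esub>"
      using that(1) E.zero_closed by (intro End_eqI) (auto simp: End_ring_def)
    then show False using that by simp
  qed
  have ideal_nonzero: "\<exists>f\<in>I. f \<in> End \<and> (\<exists>x\<in>carrier M. f x \<noteq> \<zero>\<^bsub>M\<^esub>)"
    if "ideal I (End_ring R M)" "I \<noteq> {\<zero>\<^bsub>End_ring R M\<^esub>}" for I
  proof -
    have "\<zero>\<^bsub>End_ring R M\<^esub> \<in> I" "I \<subseteq> End"
      using additive_subgroup.zero_closed[OF ideal.axioms(1)[OF that(1)]]
        additive_subgroup.a_subset[OF ideal.axioms(1)[OF that(1)]]
      by (simp_all add: End_ring_def)
    then show ?thesis using that(2) nonzero by blast
  qed
  show ?thesis
  proof (intro prime_ring.intro prime_ring_axioms.intro ring_End_ring)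
    obtain x where "x \<in> carrier M" "x \<noteq> \<zero>\<^bsub>M\<^esub>" using nontrivial M.zero_closed by blast
    then show "\<one>\<^bsub>End_ring R M\<^esub> \<noteq> \<zero>\<^bsub>End_ring R M\<^esub>"
      by (auto simp: End_ring_def dest!: fun_cong[of _ _ x])
  next
    fix I J assume I: "ideal I (End_ring R M)" and J: "ideal J (End_ring R M)"
      and IJ: "ideal_prod (End_ring R M) I J = {\<zero>\<^bsub>End_ring R M\<^esub>}"
    show "I = {\<zero>\<^bsub>End_ring R M\<^esub>} \<or> J = {\<zero>\<^bsub>End_ring R M\<^esub>}"
    proof (rule ccontr)
      assume "\<not> ?thesis"
      then obtain f g x z where f: "f \<in> I" "f \<in> End" "x \<in> carrier M" "f x \<noteq> \<zero>\<^bsub>M\<^esub>"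
        and g: "g \<in> J" "g \<in> End" "z \<in> carrier M" "g z \<noteq> \<zero>\<^bsub>M\<^esub>"
        using ideal_nonzero[OF I] ideal_nonzero[OF J] by blast
      \<comment> \<open>With \<open>y = f x\<close>, the element \<open>g (p (f x))\<close> is the
        value at \<open>x\<close> of the ring product of \<open>f\<close>, \<open>p\<close>,
        \<open>g\<close> in this order, since the left factor is applied first.\<close>
      obtain p where p: "p \<in> End" "g (p (f x)) \<noteq> \<zero>\<^bsub>M\<^esub>"
        using *[of "f x" z g] f g by auto
      have "f \<otimes>\<^bsub>End_ring R M\<^esub> p \<in> I"
        using ideal.I_r_closed[OF I f(1), of p] p(1) by (simp add: End_ring_def)
      then have "(f \<otimes>\<^bsub>End_ring R M\<^esub> p) \<otimes>\<^bsub>End_ring R M\<^esub> g = \<zero>\<^bsub>End_ring R M\<^esub>"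
        using ideal_prod.prod[OF _ g(1)] IJ by blast
      then have "g (p (f x)) = \<zero>\<^bsub>M\<^esub>"
        using f(3) by (auto simp: End_ring_def compose_def dest!: fun_cong[of _ _ x])
      then show False using p by simp
    qed
  qed
qed


section \<open>Star-prime modules\<close>

text \<open>If all homomorphisms from M to L killed x, they would kill Rx by linearity. Then Rx * L
  would be zero, although Rx and L are not.\<close>

lemma star_prime_cogenerated:
  assumes "star_prime R M" and L: "submodule L R M" "L \<noteq> {\<zero>\<^bsub>M\<^esub>}"
    and x: "x \<in> carrier M" "x \<noteq> \<zero>\<^bsub>M\<^esub>"
  obtains f where "f \<in> End" "f \<in> carrier M \<rightarrow> L" "f x \<noteq> \<zero>\<^bsub>M\<^esub>"
proof -
  have L_carrier: "L \<subseteq> carrier M" using left_submoduleD[OF L(1)] by simp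
  \<comment> \<open>The record with carrier \<open>L\<close> keeps the operations of
    \<open>M\<close>, so a homomorphism into it is an endomorphism of \<open>M\<close> with values
    in \<open>L\<close>.\<close>
  have hom: "f \<in> End \<and> f \<in> carrier M \<rightarrow> L" if "f \<in> left_module_hom R M (M\<lparr>carrier := L\<rparr>)" for f
    using that L_carrier unfolding left_module_hom_def by (auto simp: PiE_def)
  have "\<exists>f \<in> left_module_hom R M (M\<lparr>carrier := L\<rparr>). f x \<noteq> \<zero>\<^bsub>M\<^esub>"
  proof (rule ccontr)
    assume contr: "\<not> ?thesis"
    define U where "U = (\<Union>f\<in>left_module_hom R M (M\<lparr>carrier := L\<rparr>). f ` cyclic_submodule x)"
    have "U \<subseteq> {\<zero>\<^bsub>M\<^esub>}"
      using contr x(1) hom unfolding U_def cyclic_submodule_def by (auto simp: End_smult)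
    have "u = \<zero>\<^bsub>M\<^esub>" if "u \<in> generate (add_monoid M) U" for u
      using that
    proof induction
      case (inv h)
      then show ?case using \<open>U \<subseteq> {\<zero>\<^bsub>M\<^esub>}\<close> by auto
    qed (use \<open>U \<subseteq> {\<zero>\<^bsub>M\<^esub>}\<close> in auto)
    then have "star_prod R M (cyclic_submodule x) L = {\<zero>\<^bsub>M\<^esub>}"
      unfolding star_prod_def U_def using generate.one[of "add_monoid M"] by auto
    moreover have "cyclic_submodule x \<noteq> {\<zero>\<^bsub>M\<^esub>}"
      using x generator_in_cyclic_submodule by auto
    ultimately show False
      using assms submodule_cyclic_submodule[OF x(1)] unfolding star_prime_def by blast
  qed
  then show ?thesis using that hom by blast
qed

text \<open>Since r |-> rx is injective, a homomorphism h : M -> Rx has coefficients s : M -> R that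
  are themselves linear, and every w in M then gives an endomorphism m |-> s(m)w.\<close>

lemma exists_End_of_free_element:
  assumes "faithful_module R M" "star_prime R M" "\<one> \<noteq> \<zero>"
    and x: "x \<in> carrier M" "\<And>r. r \<in> carrier R \<Longrightarrow> r \<odot>\<^bsub>M\<^esub> x = \<zero>\<^bsub>M\<^esub> \<Longrightarrow> r = \<zero>"
    and y: "y \<in> carrier M" "y \<noteq> \<zero>\<^bsub>M\<^esub>"
    and g: "g \<in> End" "z \<in> carrier M" "g z \<noteq> \<zero>\<^bsub>M\<^esub>"
  shows "\<exists>p\<in>End. g (p y) \<noteq> \<zero>\<^bsub>M\<^esub>"
proof (rule ccontr)
  assume contr: "\<not> ?thesis"
  have "x \<noteq> \<zero>\<^bsub>M\<^esub>" using x(2)[of \<one>] assms(3) by auto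
  then have "cyclic_submodule x \<noteq> {\<zero>\<^bsub>M\<^esub>}" using generator_in_cyclic_submodule[OF x(1)] by auto
  then obtain h where h: "h \<in> End" "h \<in> carrier M \<rightarrow> cyclic_submodule x" "h y \<noteq> \<zero>\<^bsub>M\<^esub>"
    using star_prime_cogenerated[OF assms(2) submodule_cyclic_submodule[OF x(1)] _ y] by blast
  have "\<forall>m\<in>carrier M. \<exists>s\<in>carrier R. h m = s \<odot>\<^bsub>M\<^esub> x"
    using h(2) unfolding cyclic_submodule_def by blast
  then obtain s where s: "\<And>m. m \<in> carrier M \<Longrightarrow> s m \<in> carrier R"
      "\<And>m. m \<in> carrier M \<Longrightarrow> h m = s m \<odot>\<^bsub>M\<^esub> x" by metis
  \<comment> \<open>Coefficients with respect to \<open>x\<close> are unique; this makes the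
    pointwise choice \<open>s\<close> additive and R-linear.\<close>
  have free: "a = b" if "a \<in> carrier R" "b \<in> carrier R" "a \<odot>\<^bsub>M\<^esub> x = b \<odot>\<^bsub>M\<^esub> x" for a b
  proof -
    have "(a \<ominus> b) \<odot>\<^bsub>M\<^esub> x = \<zero>\<^bsub>M\<^esub>"
      using that x(1) smult_l_distr[of a "\<ominus> b" x]
      by (simp add: a_minus_def smult_l_minus M.r_neg)
    then show ?thesis using x(2)[of "a \<ominus> b"] that R.add.inv_solve_right'[of "\<zero>" a b] by (simp add: a_minus_def)
  qed
  have s_add: "s (u \<oplus>\<^bsub>M\<^esub> v) = s u \<oplus> s v" if "u \<in> carrier M" "v \<in> carrier M" for u v
    using that s h(1) x(1) by (intro free) (auto simp: smult_l_distr End_add s(2)[symmetric])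
  have s_smult: "s (r \<odot>\<^bsub>M\<^esub> u) = r \<otimes> s u" if "r \<in> carrier R" "u \<in> carrier M" for r u
    using that s h(1) x(1) by (intro free) (auto simp: smult_assoc1 End_smult s(2)[symmetric])
  \<comment> \<open>Taking p(m) = s(m)w in the negated claim gives 0 = g(s(y)w) = s(y)g(w).\<close>
  have "s y \<odot>\<^bsub>M\<^esub> g w = \<zero>\<^bsub>M\<^esub>" if w: "w \<in> carrier M" for w
  proof -
    have "(\<lambda>m\<in>carrier M. s m \<odot>\<^bsub>M\<^esub> w) \<in> End"
      using w s(1) by (intro End_memI) (auto simp: s_add s_smult smult_l_distr smult_assoc1)
    then show ?thesis using contr y(1) w s(1) g(1) by (auto simp: End_smult dest!: bspec)
  qed
  then have kill: "s y \<odot>\<^bsub>M\<^esub> w = \<zero>\<^bsub>M\<^esub>" if "w \<in> g ` carrier M" for w using that by auto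
  have "s y \<noteq> \<zero>" using h(3) s(2)[OF y(1)] x(1) by auto
  then obtain v where v: "v \<in> carrier M" "s y \<odot>\<^bsub>M\<^esub> v \<noteq> \<zero>\<^bsub>M\<^esub>"
    using assms(1) s(1)[OF y(1)] unfolding faithful_module_def by blast
  have "submodule (carrier M) R M" by (intro left_submoduleI) auto
  then have "submodule (g ` carrier M) R M" by (rule submodule_End_image[OF g(1)])
  moreover have "g ` carrier M \<noteq> {\<zero>\<^bsub>M\<^esub>}" using g by auto
  \<comment> \<open>Faithfulness made s(y)v non-zero, so some k : M -> g(M) does not kill it. But
    k(s(y)v) = s(y)k(v), and s(y) kills g(M).\<close>
  ultimately obtain k where k: "k \<in> End" "k \<in> carrier M \<rightarrow> g ` carrier M" "k (s y \<odot>\<^bsub>M\<^esub> v) \<noteq> \<zero>\<^bsub>M\<^esub>"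
    using star_prime_cogenerated[OF assms(2), of _ "s y \<odot>\<^bsub>M\<^esub> v"] v s(1)[OF y(1)]
    by (metis smult_closed)
  then have "k (s y \<odot>\<^bsub>M\<^esub> v) = s y \<odot>\<^bsub>M\<^esub> k v" using v s(1)[OF y(1)] by (simp add: End_smult)
  also have "\<dots> = \<zero>\<^bsub>M\<^esub>" using k(2) v kill by auto
  finally show False using k(3) by simp
qed


section \<open>Descending chains\<close>

text \<open>For a submodule \<open>C\<close> this says that \<open>C\<close> is artinian. It is
  phrased through submodules of \<open>M\<close> inside \<open>C\<close>, so that all chains live in
  the one module \<open>M\<close>.\<close>

definition dcc_below :: "'b set \<Rightarrow> bool" where
  "dcc_below C \<longleftrightarrow> (\<forall>N :: nat \<Rightarrow> 'b set.
     (\<forall>i. submodule (N i) R M \<and> N i \<subseteq> C \<and> N (Suc i) \<subseteq> N i) \<longrightarrow> (\<exists>n. \<forall>i\<ge>n. N i = N n))"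

text \<open>If no such submodule were minimal, dependent choice would build a strictly descending
  chain below \<open>C\<close>. Minimality ranges over all submodules of \<open>D\<close>, as these
  lie in \<open>C\<close> anyway.\<close>

lemma dcc_below_minimal:
  assumes "dcc_below C" "submodule C R M" "P C"
  obtains D where "submodule D R M" "D \<subseteq> C" "P D"
    "\<And>D'. submodule D' R M \<Longrightarrow> D' \<subseteq> D \<Longrightarrow> P D' \<Longrightarrow> D' = D"
proof (rule ccontr)
  note result = that
  define Q where "Q D \<longleftrightarrow> submodule D R M \<and> D \<subseteq> C \<and> P D" for D
  assume "\<not> thesis"
  then have step: "\<exists>D'. Q D' \<and> D' \<subset> D" if "Q D" for D
    using that result
    unfolding Q_def by (metis order_trans psubsetI)
  have "\<exists>N. \<forall>n. Q (N n) \<and> N (Suc n) \<subset> N n"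
    using assms step by (intro dependent_nat_choice) (auto simp: Q_def)
  then obtain N where N: "\<And>n. Q (N n)" "\<And>n. N (Suc n) \<subset> N n" by blast
  then obtain n where n: "\<forall>i\<ge>n. N i = N n"
    using assms(1) unfolding dcc_below_def Q_def by (metis psubset_imp_subset)
  have "N (Suc n) = N n" by (rule n[rule_format]) simp
  then show False using N(2)[of n] by simp
qed

text \<open>Any h : M -> S that does not vanish at a point c of C with g(c) non-zero restricts to an
  isomorphism from C to S. Surjectivity comes from simplicity of S, injectivity from minimality of
  C.\<close>

lemma exists_End_of_dcc:
  assumes sp: "star_prime R M" and dcc: "\<And>x. x \<in> carrier M \<Longrightarrow> dcc_below (cyclic_submodule x)"
    and y: "y \<in> carrier M" "y \<noteq> \<zero>\<^bsub>M\<^esub>"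
    and g: "g \<in> End" "z \<in> carrier M" "g z \<noteq> \<zero>\<^bsub>M\<^esub>"
  shows "\<exists>p\<in>End. g (p y) \<noteq> \<zero>\<^bsub>M\<^esub>"
proof -
  have "cyclic_submodule y \<noteq> {\<zero>\<^bsub>M\<^esub>}" using y generator_in_cyclic_submodule by auto
  \<comment> \<open>A minimal non-zero submodule of Ry is simple.\<close>
  then obtain S where S: "submodule S R M" "S \<noteq> {\<zero>\<^bsub>M\<^esub>}"
    and S_min: "\<And>D. submodule D R M \<Longrightarrow> D \<subseteq> S \<Longrightarrow> D \<noteq> {\<zero>\<^bsub>M\<^esub>} \<Longrightarrow> D = S"
    using dcc_below_minimal[OF dcc[OF y(1)] submodule_cyclic_submodule[OF y(1)],
        of "\<lambda>D. D \<noteq> {\<zero>\<^bsub>M\<^esub>}"] by metis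
  have "\<exists>c\<in>cyclic_submodule z. g c \<noteq> \<zero>\<^bsub>M\<^esub>"
    using g generator_in_cyclic_submodule by blast
  then obtain C where C: "submodule C R M" "\<exists>c\<in>C. g c \<noteq> \<zero>\<^bsub>M\<^esub>"
    and C_min: "\<And>D. submodule D R M \<Longrightarrow> D \<subseteq> C \<Longrightarrow> \<exists>c\<in>D. g c \<noteq> \<zero>\<^bsub>M\<^esub> \<Longrightarrow> D = C"
    using dcc_below_minimal[OF dcc[OF g(2)] submodule_cyclic_submodule[OF g(2)],
        of "\<lambda>D. \<exists>c\<in>D. g c \<noteq> \<zero>\<^bsub>M\<^esub>"] by metis
  note CD = left_submoduleD[OF C(1)]
  obtain c where c: "c \<in> C" "g c \<noteq> \<zero>\<^bsub>M\<^esub>" using C(2) by blast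
  have cM: "c \<in> carrier M" using c(1) CD(1) by auto
  \<comment> \<open>The image of \<open>N\<close> is a non-zero submodule of the simple module
    \<open>S\<close>.\<close>
  have onto: "h ` N = S"
    if "h \<in> End" "h \<in> carrier M \<rightarrow> S" "submodule N R M" "x \<in> N" "h x \<noteq> \<zero>\<^bsub>M\<^esub>" for h N x
    using that left_submoduleD(1)[OF that(3)]
    by (intro S_min submodule_End_image) auto
  have "c \<noteq> \<zero>\<^bsub>M\<^esub>" using c(2) End_zero[OF g(1)] by auto
  then obtain h where h: "h \<in> End" "h \<in> carrier M \<rightarrow> S" "h c \<noteq> \<zero>\<^bsub>M\<^esub>"
    using star_prime_cogenerated[OF sp S cM] by blast
  \<comment> \<open>If \<open>K\<close> were non-zero, some \<open>h' : M \<rightarrow> S\<close> would not vanish on it. Simplicity of \<open>S\<close> then gives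
    \<open>C = K + K'\<close> with \<open>K' = C \<inter> ker h'\<close>, and \<open>g\<close> kills both summands.\<close>
  define K where "K = {x \<in> C. h x = \<zero>\<^bsub>M\<^esub>}"
  have K: "submodule K R M" unfolding K_def by (rule submodule_inter_kernel[OF h(1) C(1)])
  \<comment> \<open>\<open>K\<close> does not contain \<open>c\<close>, so it is a proper submodule
    of \<open>C\<close>, and minimality of \<open>C\<close> forces \<open>g\<close> to vanish on
    it.\<close>
  have gK: "g k = \<zero>\<^bsub>M\<^esub>" if "k \<in> K" for k
    using C_min[OF K] that h(3) c(1) unfolding K_def by blast
  have K_zero: "k = \<zero>\<^bsub>M\<^esub>" if k: "k \<in> K" for k
  proof (rule ccontr)
    assume "k \<noteq> \<zero>\<^bsub>M\<^esub>"
    moreover have kM: "k \<in> carrier M" using k left_submoduleD(1)[OF K] by auto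
    ultimately obtain h' where h': "h' \<in> End" "h' \<in> carrier M \<rightarrow> S" "h' k \<noteq> \<zero>\<^bsub>M\<^esub>"
      using star_prime_cogenerated[OF sp S] by metis
    define K' where "K' = {x \<in> C. h' x = \<zero>\<^bsub>M\<^esub>}"
    have K': "submodule K' R M" unfolding K'_def by (rule submodule_inter_kernel[OF h'(1) C(1)])
    \<comment> \<open>The same argument applies to \<open>K'\<close>, which misses the element
      \<open>k\<close> of \<open>C\<close>.\<close>
    have gK': "g u = \<zero>\<^bsub>M\<^esub>" if "u \<in> K'" for u
      using C_min[OF K'] that h'(3) k unfolding K'_def K_def by blast
    \<comment> \<open>As h'(K) = S, some d in K has the same image as c. This splits c as d + (c -
      d) with c - d in K'.\<close>
    have "h' c \<in> h' ` K" using onto[OF h'(1,2) K k h'(3)] h'(2) cM by auto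
    then obtain d where d: "d \<in> K" "h' c = h' d" by auto
    have dM: "d \<in> carrier M" "d \<in> C" using d(1) CD(1) unfolding K_def by auto
    have "h' (c \<ominus>\<^bsub>M\<^esub> d) = \<zero>\<^bsub>M\<^esub>"
      using d(2) h'(1) cM dM by (simp add: End_minus[unfolded a_minus_def] M.r_neg a_minus_def)
    then have "c \<ominus>\<^bsub>M\<^esub> d \<in> K'" using CD(6)[OF c(1) dM(2)] by (simp add: K'_def)
    then have "g c \<ominus>\<^bsub>M\<^esub> g d = \<zero>\<^bsub>M\<^esub>" using gK' g(1) cM dM(1) by (simp add: End_minus[symmetric])
    then show False using gK[OF d(1)] c(2) g(1) cM M.add.inv_solve_right'[of "\<zero>\<^bsub>M\<^esub>" "g c" "g d"]
      by (simp add: a_minus_def)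
  qed
  have inj: "inj_on h C"
  proof (rule inj_onI)
    fix u v assume uv: "u \<in> C" "v \<in> C" "h u = h v"
    then have uvM: "u \<in> carrier M" "v \<in> carrier M" using CD(1) by auto
    have "h (u \<ominus>\<^bsub>M\<^esub> v) = \<zero>\<^bsub>M\<^esub>"
      using uv(3) h(1) uvM by (simp add: End_minus[unfolded a_minus_def] M.r_neg a_minus_def)
    then have "u \<ominus>\<^bsub>M\<^esub> v = \<zero>\<^bsub>M\<^esub>" using CD(6)[OF uv(1,2)] by (intro K_zero) (simp add: K_def)
    then show "u = v" using uvM M.add.inv_solve_right'[of "\<zero>\<^bsub>M\<^esub>" u v] by (simp add: a_minus_def)
  qed
  have hC: "h ` C = S" by (rule onto[OF h(1,2) C(1) c(1) h(3)])
  \<comment> \<open>The inverse of the isomorphism \<open>h\<close> from \<open>C\<close> to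
    \<open>S\<close>; it is only ever evaluated on \<open>S\<close>.\<close>
  define t where "t = inv_into C h"
  have t: "t s \<in> C" "t s \<in> carrier M" "h (t s) = s" if "s \<in> S" for s
  proof -
    have "s \<in> h ` C" using that hC by simp
    then show "t s \<in> C" "h (t s) = s" unfolding t_def by (rule inv_into_into, rule f_inv_into_f)
    then show "t s \<in> carrier M" using CD(1) by blast
  qed
  \<comment> \<open>Linearity of \<open>t\<close> follows from this: a proposed value in
    \<open>C\<close> is confirmed by computing its image under \<open>h\<close>.\<close>
  have t_eq: "t s = u" if "u \<in> C" "h u = s" for s u
    using inv_into_f_f[OF inj that(1)] that(2) unfolding t_def by simp
  obtain k where k: "k \<in> End" "k \<in> carrier M \<rightarrow> S" "k y \<noteq> \<zero>\<^bsub>M\<^esub>"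
    using star_prime_cogenerated[OF sp S y] by blast
  have kS: "k x \<in> S" if "x \<in> carrier M" for x using k(2) that by auto
  define p where "p = (\<lambda>x\<in>carrier M. t (k x))"
  have p: "p \<in> End"
    unfolding p_def
  proof (rule End_memI)
    fix u v assume uv: "u \<in> carrier M" "v \<in> carrier M"
    show "t (k (u \<oplus>\<^bsub>M\<^esub> v)) = t (k u) \<oplus>\<^bsub>M\<^esub> t (k v)"
      using uv t[OF kS] h(1) k(1) CD(3) by (intro t_eq) (auto simp: End_add)
  next
    fix r u assume ru: "r \<in> carrier R" "u \<in> carrier M"
    show "t (k (r \<odot>\<^bsub>M\<^esub> u)) = r \<odot>\<^bsub>M\<^esub> t (k u)"
      using ru t[OF kS] h(1) k(1) CD(4) by (intro t_eq) (auto simp: End_smult)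
  qed (use t[OF kS] in auto)
  \<comment> \<open>By simplicity k(Ry) = S, so some ry satisfies k(ry) = h(c). Then p(ry) = c, and
    r g(p(y)) = g(c) is non-zero.\<close>
  have "h c \<in> k ` cyclic_submodule y"
    using onto[OF k(1,2) submodule_cyclic_submodule[OF y(1)] generator_in_cyclic_submodule[OF y(1)] k(3)]
      h(2) cM by auto
  then obtain r where r: "r \<in> carrier R" "k (r \<odot>\<^bsub>M\<^esub> y) = h c"
    unfolding cyclic_submodule_def by auto
  have "p (r \<odot>\<^bsub>M\<^esub> y) = c" using r y(1) t_eq[OF c(1) refl] by (simp add: p_def)
  then have "r \<odot>\<^bsub>M\<^esub> g (p y) = g c" using r(1) y(1) p g(1) by (simp add: End_smult[symmetric])
  then have "g (p y) \<noteq> \<zero>\<^bsub>M\<^esub>" using c(2) r(1) by auto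
  then show ?thesis using p by blast
qed

end


section \<open>Cyclic modules as quotients of the ring\<close>

lemma (in ring) left_module_regular_module: "left_module R (regular_module R)"
proof -
  have "abelian_group (regular_module R)"
    by (rule abelian_groupI)
      (auto simp: regular_module_def a_ac intro: exI[of _ "\<ominus> x" for x] l_neg)
  then show ?thesis
    by (intro left_module.intro ring_axioms left_module_axioms.intro)
      (auto simp: regular_module_def m_assoc l_distr r_distr)
qed

context left_module
begin

text \<open>Preimages under the homomorphism r |-> rx from R to M. The zero submodule gives the
  annihilator of x, and a chain below Rx pulls back to left ideals above it.\<close>

lemma left_ideal_preimage:
  assumes "x \<in> carrier M" "submodule N R M"
  shows "left_ideal {r \<in> carrier R. r \<odot>\<^bsub>M\<^esub> x \<in> N} R"
proof -
  note N = left_submoduleD[OF assms(2)]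
  show ?thesis
    using N assms
    by (intro left_module.left_submoduleI[OF R.left_module_regular_module])
      (auto simp: regular_module_def smult_l_distr smult_assoc1)
qed

text \<open>Used to push a chain of left ideals into R/A. The record operations are defined on whole
  cosets, so they are first computed on representatives.\<close>

lemma submodule_quotient_module:
  assumes A: "submodule A R M" and I: "submodule I R M"
  shows "submodule ((\<lambda>x. A +>\<^bsub>M\<^esub> x) ` I) R (quotient_module R M A)"
proof -
  note AD = left_submoduleD[OF A] and ID = left_submoduleD[OF I]
  let ?Q = "quotient_module R M A"
  interpret A: abelian_subgroup A M
    by (intro abelian_subgroupI3 additive_subgroup.intro submodule.axioms(1)[OF A] M.abelian_group_axioms)
  \<comment> \<open>For every representative u of A + x, the element ru lies in A + rx because A
    absorbs scalars. Hence the union that defines the scalar action is a single coset.\<close>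
  have smult: "r \<odot>\<^bsub>?Q\<^esub> (A +>\<^bsub>M\<^esub> x) = A +>\<^bsub>M\<^esub> (r \<odot>\<^bsub>M\<^esub> x)"
    if r: "r \<in> carrier R" and x: "x \<in> carrier M" for r x
  proof -
    have "A +>\<^bsub>M\<^esub> (r \<odot>\<^bsub>M\<^esub> u) = A +>\<^bsub>M\<^esub> (r \<odot>\<^bsub>M\<^esub> x)" if u: "u \<in> A +>\<^bsub>M\<^esub> x" for u
    proof -
      obtain a where a: "a \<in> A" "u = a \<oplus>\<^bsub>M\<^esub> x" using u by (auto simp: a_r_coset_def')
      have "r \<odot>\<^bsub>M\<^esub> u = r \<odot>\<^bsub>M\<^esub> a \<oplus>\<^bsub>M\<^esub> r \<odot>\<^bsub>M\<^esub> x" using a AD(1) r x by (auto simp: smult_r_distr)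
      then have "r \<odot>\<^bsub>M\<^esub> u \<in> A +>\<^bsub>M\<^esub> (r \<odot>\<^bsub>M\<^esub> x)"
        using AD(4)[OF r a(1)] by (auto simp: a_r_coset_def')
      then show ?thesis using A.a_repr_independence' r x by (metis smult_closed)
    qed
    moreover have "x \<in> A +>\<^bsub>M\<^esub> x" using A.a_rcos_self[OF x] .
    ultimately have "(\<Union>u\<in>A +>\<^bsub>M\<^esub> x. A +>\<^bsub>M\<^esub> (r \<odot>\<^bsub>M\<^esub> u)) = A +>\<^bsub>M\<^esub> (r \<odot>\<^bsub>M\<^esub> x)"
      by (intro SUP_eq_const) blast+
    then show ?thesis by (simp add: quotient_module_def)
  qed
  have add: "(A +>\<^bsub>M\<^esub> x) \<oplus>\<^bsub>?Q\<^esub> (A +>\<^bsub>M\<^esub> y) = A +>\<^bsub>M\<^esub> (x \<oplus>\<^bsub>M\<^esub> y)"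
    if "x \<in> carrier M" "y \<in> carrier M" for x y
    using that by (simp add: quotient_module_def A.a_rcos_sum)
  have zero: "\<zero>\<^bsub>?Q\<^esub> = A +>\<^bsub>M\<^esub> \<zero>\<^bsub>M\<^esub>"
    using AD(1) by (simp add: quotient_module_def M.a_coset_add_zero)
  have carrier: "carrier ?Q = (\<lambda>x. A +>\<^bsub>M\<^esub> x) ` carrier M"
    by (auto simp: quotient_module_def A_RCOSETS_def')
  have sub: "(\<lambda>x. A +>\<^bsub>M\<^esub> x) ` I \<subseteq> carrier ?Q"
    unfolding carrier by (rule image_mono[OF ID(1)])
  \<comment> \<open>\<open>subgroup\<close> speaks of inverses in the additive monoid of the
    quotient; the group structure allows them to be identified as the cosets of the
    negatives.\<close>
  interpret Q: group "add_monoid ?Q"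
  proof (rule groupI)
    fix u assume "u \<in> carrier (add_monoid ?Q)"
    then obtain x where "x \<in> carrier M" "u = A +>\<^bsub>M\<^esub> x" by (auto simp: carrier)
    then show "\<exists>v\<in>carrier (add_monoid ?Q). v \<otimes>\<^bsub>add_monoid ?Q\<^esub> u = \<one>\<^bsub>add_monoid ?Q\<^esub>"
      by (auto simp: carrier add zero M.l_neg intro!: bexI[of _ "\<ominus>\<^bsub>M\<^esub> x"])
  qed (auto simp: carrier add zero M.a_assoc)
  show ?thesis
  proof (intro submodule.intro Q.subgroupI submodule_axioms.intro)
    fix u assume "u \<in> (\<lambda>x. A +>\<^bsub>M\<^esub> x) ` I"
    then obtain x where x: "x \<in> I" "x \<in> carrier M" "u = A +>\<^bsub>M\<^esub> x" using ID(1) by auto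
    have "inv\<^bsub>add_monoid ?Q\<^esub> u = A +>\<^bsub>M\<^esub> (\<ominus>\<^bsub>M\<^esub> x)"
    proof (rule Q.inv_equality)
      show "(A +>\<^bsub>M\<^esub> (\<ominus>\<^bsub>M\<^esub> x)) \<otimes>\<^bsub>add_monoid ?Q\<^esub> u = \<one>\<^bsub>add_monoid ?Q\<^esub>"
        using add[of "\<ominus>\<^bsub>M\<^esub> x" x] zero x by (simp add: M.l_neg)
    qed (use sub x ID(5) in auto)
    then show "inv\<^bsub>add_monoid ?Q\<^esub> u \<in> (\<lambda>x. A +>\<^bsub>M\<^esub> x) ` I" using ID(5) x(1) by auto
    fix v assume "v \<in> (\<lambda>x. A +>\<^bsub>M\<^esub> x) ` I"
    then obtain y where "y \<in> I" "y \<in> carrier M" "v = A +>\<^bsub>M\<^esub> y" using ID(1) by auto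
    then show "u \<otimes>\<^bsub>add_monoid ?Q\<^esub> v \<in> (\<lambda>x. A +>\<^bsub>M\<^esub> x) ` I"
      using add[of x y] x ID(3) by auto
  next
    fix r u assume "r \<in> carrier R" "u \<in> (\<lambda>x. A +>\<^bsub>M\<^esub> x) ` I"
    then show "r \<odot>\<^bsub>?Q\<^esub> u \<in> (\<lambda>x. A +>\<^bsub>M\<^esub> x) ` I"
      using ID(1,4) smult by auto
  qed (use sub ID(2) in auto)
qed

text \<open>The injective half of the correspondence theorem: an element of \<open>I\<close> is
  congruent modulo \<open>A\<close> to some element of \<open>J\<close>, and \<open>J\<close>
  absorbs the difference.\<close>

lemma coset_image_inj:
  assumes A: "submodule A R M" and I: "submodule I R M" and J: "submodule J R M"
    and "A \<subseteq> J" "(\<lambda>x. A +>\<^bsub>M\<^esub> x) ` I \<subseteq> (\<lambda>x. A +>\<^bsub>M\<^esub> x) ` J"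
  shows "I \<subseteq> J"
proof
  interpret A: abelian_subgroup A M
    by (intro abelian_subgroupI3 additive_subgroup.intro submodule.axioms(1)[OF A] M.abelian_group_axioms)
  fix x assume "x \<in> I"
  moreover then have "x \<in> carrier M" using left_submoduleD(1)[OF I] by auto
  ultimately obtain y where "y \<in> J" "x \<in> A +>\<^bsub>M\<^esub> y"
    using assms(5) A.a_rcos_self by blast
  then show "x \<in> J" using left_submoduleD(3)[OF J] assms(4) by (auto simp: a_r_coset_def')
qed

text \<open>Rx is isomorphic to R/A with A the annihilator of x, which is non-zero as it contains a.
  Instead of forming the isomorphism, the proof pulls a chain in Rx back to left ideals and maps
  these into the artinian module R/A.\<close>

lemma dcc_below_cyclic_submodule:
  assumes "left_krull_dim_le_1 R" and x: "x \<in> carrier M"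
    and a: "a \<in> carrier R" "a \<noteq> \<zero>" "a \<odot>\<^bsub>M\<^esub> x = \<zero>\<^bsub>M\<^esub>"
  shows "dcc_below (cyclic_submodule x)"
  unfolding dcc_below_def
proof (intro allI impI)
  interpret RM: left_module R "regular_module R" by (rule R.left_module_regular_module)
  let ?Q = "\<lambda>A. quotient_module R (regular_module R) A"
  define I where "I N = {r \<in> carrier R. r \<odot>\<^bsub>M\<^esub> x \<in> N}" for N
  have I: "left_ideal (I N) R" if "submodule N R M" for N
    unfolding I_def by (rule left_ideal_preimage[OF x that])
  define A where "A = I {\<zero>\<^bsub>M\<^esub>}"
  have A: "left_ideal A R" unfolding A_def by (intro I left_submoduleI) auto
  fix N :: "nat \<Rightarrow> 'b set"
  assume "\<forall>i. submodule (N i) R M \<and> N i \<subseteq> cyclic_submodule x \<and> N (Suc i) \<subseteq> N i"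
  then have N: "\<And>i. submodule (N i) R M" "\<And>i. N i \<subseteq> cyclic_submodule x" "\<And>i. N (Suc i) \<subseteq> N i"
    by auto
  \<comment> \<open>Being contained in Rx, each \<open>N i\<close> is recovered from its left ideal,
    so stability of the ideals passes back to the chain.\<close>
  have N_eq: "N i = (\<lambda>r. r \<odot>\<^bsub>M\<^esub> x) ` I (N i)" for i
    using N(2)[of i] unfolding I_def cyclic_submodule_def by auto
  let ?q = "\<lambda>r. A +>\<^bsub>regular_module R\<^esub> r"
  have "A \<noteq> {\<zero>}" using a unfolding A_def I_def by auto
  then have "artinian_module R (?Q A)" using assms(1) A unfolding left_krull_dim_le_1_def by blast
  moreover have "\<forall>i. submodule (?q ` I (N i)) R (?Q A)"
    using RM.submodule_quotient_module[OF A I[OF N(1)]] by blast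
  moreover have "\<forall>i. ?q ` I (N (Suc i)) \<subseteq> ?q ` I (N i)"
    using N(3) unfolding I_def by blast
  ultimately obtain n where n: "\<forall>i\<ge>n. ?q ` I (N i) = ?q ` I (N n)"
    unfolding artinian_module_def by (elim allE[of _ "\<lambda>i. ?q ` I (N i)"]) blast
  \<comment> \<open>Left ideals containing \<open>A\<close> are determined by their images in R/A,
    so the chain of ideals stabilises where its image does.\<close>
  have "A \<subseteq> I (N i)" for i
    using left_submoduleD(2)[OF N(1)] unfolding A_def I_def by auto
  then have "I (N i) = I (N n)" if "i \<ge> n" for i
    using that n RM.coset_image_inj[OF A I[OF N(1)] I[OF N(1)]] by (metis subset_antisym order_refl)
  then show "\<exists>n. \<forall>i\<ge>n. N i = N n" using N_eq by metis
qed

end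

theorem mainTheorem10:
  fixes R :: "('a, 'c) ring_scheme" and M :: "('a, 'b, 'd) module_scheme"
  assumes "prime_ring R"
    and "left_krull_dim_le_1 R"
    and "left_module R M"
    and "faithful_module R M"
    and "star_prime R M"
  shows "prime_ring (End_ring R M)"
proof -
  interpret left_module R M by fact
  have one: "\<one>\<^bsub>R\<^esub> \<noteq> \<zero>\<^bsub>R\<^esub>" using assms(1) by (rule prime_ring.one_neq_zero)
  show ?thesis
  proof (rule prime_ring_End_ringI)
    \<comment> \<open>On a zero module the scalar 1 would act as zero, and faithfulness would give 1
      = 0 in R.\<close>
    show "carrier M \<noteq> {\<zero>\<^bsub>M\<^esub>}"
      using assms(4) one R.one_closed unfolding faithful_module_def by fastforce
  next
    fix y z g
    assume yzg: "y \<in> carrier M" "y \<noteq> \<zero>\<^bsub>M\<^esub>" "z \<in> carrier M" "g \<in> End" "g z \<noteq> \<zero>\<^bsub>M\<^esub>"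
    show "\<exists>p\<in>End. g (p y) \<noteq> \<zero>\<^bsub>M\<^esub>"
    \<comment> \<open>Either some element has zero annihilator, or every element is killed by a
      non-zero scalar and all cyclic submodules satisfy the descending chain condition.\<close>
    proof (cases "\<exists>x\<in>carrier M. \<forall>r\<in>carrier R. r \<odot>\<^bsub>M\<^esub> x = \<zero>\<^bsub>M\<^esub> \<longrightarrow> r = \<zero>\<^bsub>R\<^esub>")
      case True
      then show ?thesis using exists_End_of_free_element[OF assms(4,5) one] yzg by metis
    next
      case False
      then show ?thesis
        using exists_End_of_dcc[OF assms(5)] dcc_below_cyclic_submodule[OF assms(2)] yzg by metis
    qed
  qed
qed

end
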